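(* For each integer $n \geq 2$, find the largest integer $k$ (in terms of $n$) such that there exists a set of $n$ distinct points in the coordinate plane that is not overdetermined, but has $k$ overdetermined subsets.
   Context: A finite set $S$ of points in the coordinate plane is called overdetermined if $|S| \geq 2$ and there exists a nonzero polynomial $P(t)$, with real coefficients and of degree at most $|S|-2$, satisfying $P(x)=y$ for every point $(x,y) \in S$. *)

theory Defs
  imports Complex_Main "HOL-Computational_Algebra.Polynomial"
begin

definition overdetermined :: "(real \<times> real) set \<Rightarrow> bool" where
  "overdetermined S \<longleftrightarrow> finite S \<and> card S \<ge> 2 \<and>
     (\<exists>P :: real poly. P \<noteq> 0 \<and> degree P \<le> card S - 2 \<and> (\<forall>(x, y) \<in> S. poly P x = y))"

definition admits_overdetermined_count :: "nat \<Rightarrow> int \<Rightarrow> bool" where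
  "admits_overdetermined_count n k \<longleftrightarrow>
     (\<exists>S :: (real \<times> real) set. finite S \<and> card S = n \<and> \<not> overdetermined S \<and>
        int (card {T. T \<subseteq> S \<and> overdetermined T}) = k)"

end

theory Submission
  imports Defs
begin

text \<open>
  If a set \<open>A\<close> with at least three points had two overdetermined subsets \<open>A - {a}\<close> and \<open>A - {b}\<close>,
  their polynomials would agree on the \<open>card A - 2\<close> common points, hence coincide, and \<open>A\<close> itself
  would be overdetermined. So a non-overdetermined set of size \<open>k + 1\<close> has at least \<open>k\<close>
  non-overdetermined subsets of size \<open>k\<close>; double counting these inclusions downwards from a
  non-overdetermined set of size \<open>n\<close> gives at least \<open>(n - 1) choose (k - 1)\<close>
  non-overdetermined subsets of each size \<open>k \<ge> 2\<close>. Equality holds for \<open>n - 1\<close> points on a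
  horizontal line other than the \<open>x\<close>-axis together with one point off it.
\<close>

text \<open>Since \<open>A\<close> lies on the graph of \<open>P\<close>, its points have distinct
  abscissae, so \<open>P\<close> and \<open>Q\<close> agree at \<open>card A\<close> arguments, more
  than either degree.\<close>

lemma poly_eq_of_common_points:
  fixes P Q :: "real poly"
  assumes P: "\<forall>(x, y) \<in> A. poly P x = y" and Q: "\<forall>(x, y) \<in> A. poly Q x = y"
    and deg: "degree P < card A" "degree Q < card A"
  shows "P = Q"
proof (rule poly_eqI_degree)
  have "inj_on fst A"
    using P by (intro inj_onI) (metis (mono_tags, lifting) case_prod_beta prod.expand)
  then have c: "card (fst ` A) = card A"
    by (rule card_image)
  show "poly P x = poly Q x" if "x \<in> fst ` A" for x
    using that P Q by fastforce
  show "degree P < card (fst ` A)" "degree Q < card (fst ` A)"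
    using deg c by auto
qed

lemma overdetermined_removals_unique:
  assumes A: "finite A" "card A \<ge> 3" "\<not> overdetermined A" and "a \<in> A" "b \<in> A"
    and over: "overdetermined (A - {a})" "overdetermined (A - {b})"
  shows "a = b"
proof (rule ccontr)
  assume ab: "a \<noteq> b"
  obtain P where P: "P \<noteq> 0" "degree P \<le> card A - 3" "\<forall>(x, y) \<in> A - {a}. poly P x = y"
    using over(1) A \<open>a \<in> A\<close> unfolding overdetermined_def by (auto simp: card_Diff_singleton numeral_3_eq_3)
  obtain Q where Q: "degree Q \<le> card A - 3" "\<forall>(x, y) \<in> A - {b}. poly Q x = y"
    using over(2) A \<open>b \<in> A\<close> unfolding overdetermined_def by (auto simp: card_Diff_singleton numeral_3_eq_3)
  have c: "card (A - {a} - {b}) = card A - 2"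
    using A ab \<open>a \<in> A\<close> \<open>b \<in> A\<close> by (simp add: card_Diff_singleton)
  \<comment> \<open>Both degrees are at most \<open>card A - 3\<close>, one less than the number of
    common points.\<close>
  have "P = Q"
    by (rule poly_eq_of_common_points[of "A - {a} - {b}"]) (use A P Q c in auto)
  then have "\<forall>(x, y) \<in> (A - {a}) \<union> (A - {b}). poly P x = y"
    using P(3) Q(2) by (simp only: ball_Un simp_thms)
  moreover have "(A - {a}) \<union> (A - {b}) = A"
    using ab by auto
  ultimately have "\<forall>(x, y) \<in> A. poly P x = y"
    by simp
  then have "overdetermined A"
    using A P unfolding overdetermined_def by (auto intro!: exI[of _ P])
  with A show False by blast
qed

text \<open>The double count, for an arbitrary predicate \<open>good\<close>; it is applied to sets
  that are not overdetermined. The induction descends from size \<open>n\<close>, where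
  \<open>S\<close> is the only candidate.\<close>

lemma card_subsets_downward_ge:
  assumes S: "finite S" "card S = n" "n \<ge> 1" "good S"
    and down: "\<And>A. A \<subseteq> S \<Longrightarrow> good A \<Longrightarrow> card A > m \<Longrightarrow>
      card A - 1 \<le> card {a \<in> A. good (A - {a})}"
    and k: "m \<le> k" "1 \<le> k" "k \<le> n"
  shows "(n - 1) choose (k - 1) \<le> card {A. A \<subseteq> S \<and> card A = k \<and> good A}"
  using k(3,1,2)
proof (induction k rule: inc_induct)
  case base
  have "{A. A \<subseteq> S \<and> card A = n \<and> good A} = {S}"
    using S card_subset_eq[of S] by auto
  then show ?case by simp
next
  case (step k)
  let ?G = "\<lambda>k. {A. A \<subseteq> S \<and> card A = k \<and> good A}"
  have fin: "finite (?G j)" for j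
    using S(1) by (auto intro: finite_subset[of _ "Pow S"])
  have finsub: "finite A" if "A \<subseteq> S" for A
    using that S(1) finite_subset by blast
  \<comment> \<open>Each inclusion of a good \<open>k\<close>-set in a good set one larger is
    recorded twice: in \<open>?L\<close> by the larger set and the removed point, in
    \<open>?R\<close> by the smaller set and the added point. Each \<open>k\<close>-set has only
    \<open>n - k\<close> points to add.\<close>
  let ?L = "Sigma (?G (Suc k)) (\<lambda>A. {a \<in> A. good (A - {a})})"
  let ?R = "Sigma (?G k) (\<lambda>B. S - B)"
  have "k * card (?G (Suc k)) = (\<Sum>A\<in>?G (Suc k). k)"
    by simp
  also have "\<dots> \<le> (\<Sum>A\<in>?G (Suc k). card {a \<in> A. good (A - {a})})"
  proof (rule sum_mono)
    fix A assume "A \<in> ?G (Suc k)"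
    then show "k \<le> card {a \<in> A. good (A - {a})}"
      using down[of A] step.prems by simp
  qed
  also have "\<dots> = card ?L"
    by (rule card_SigmaI[symmetric]) (use fin finsub in auto)
  also have "\<dots> \<le> card ?R"
  proof (rule card_inj_on_le[where f = "\<lambda>(A, a). (A - {a}, a)"])
    show "inj_on (\<lambda>(A, a). (A - {a}, a)) ?L"
      by (auto simp: inj_on_def)
    show "(\<lambda>(A, a). (A - {a}, a)) ` ?L \<subseteq> ?R"
      using finsub by (auto simp: card_Diff_singleton)
    show "finite ?R"
      using fin S(1) by auto
  qed
  also have "card ?R = (\<Sum>B\<in>?G k. card (S - B))"
    by (rule card_SigmaI) (use fin S(1) in auto)
  also have "\<dots> = (\<Sum>B\<in>?G k. n - k)"
    by (rule sum.cong) (use S finsub in \<open>auto simp: card_Diff_subset\<close>)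
  finally have "k * card (?G (Suc k)) \<le> (n - k) * card (?G k)"
    by (simp add: mult.commute)
  moreover have "(n - 1) choose k \<le> card (?G (Suc k))"
    using step by simp
  \<comment> \<open>Both sides equal \<open>(n - 1) * ((n - 2) choose (k - 1))\<close>.\<close>
  moreover have "k * ((n - 1) choose k) = (n - k) * ((n - 1) choose (k - 1))"
    using step.prems binomial_absorb_comp[of "n - 1" "k - 1"] binomial_absorption[of "k - 1" "n - 1"]
    by simp
  ultimately have "(n - k) * ((n - 1) choose (k - 1)) \<le> (n - k) * card (?G k)"
    using mult_le_mono2[of "(n - 1) choose k" "card (?G (Suc k))" k] by linarith
  then show ?case
    using step.hyps by simp
qed

text \<open>Complementary count: by Pascal's rule, removing at least
  \<open>(n - 1) choose (k - 1)\<close> sets from the \<open>n choose k\<close> subsets of size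
  \<open>k\<close> leaves at most \<open>(n - 1) choose k\<close>.\<close>

lemma card_overdetermined_subsets_of_size_le:
  assumes S: "finite S" "card S = n" "n \<ge> 2" "\<not> overdetermined S" and k: "2 \<le> k" "k \<le> n"
  shows "card {T. T \<subseteq> S \<and> card T = k \<and> overdetermined T} \<le> (n - 1) choose k"
proof -
  let ?O = "{T. T \<subseteq> S \<and> card T = k \<and> overdetermined T}"
  let ?N = "{T. T \<subseteq> S \<and> card T = k \<and> \<not> overdetermined T}"
  have "(n - 1) choose (k - 1) \<le> card ?N"
  proof (rule card_subsets_downward_ge[where m = 2])
    fix A assume A: "A \<subseteq> S" "\<not> overdetermined A" "2 < card A"
    let ?B = "{a \<in> A. overdetermined (A - {a})}"
    have finA: "finite A"
      using A S finite_subset by blast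
    have "a = b" if "a \<in> ?B" "b \<in> ?B" for a b
      using that overdetermined_removals_unique[of A a b] A finA by auto
    then have "card ?B \<le> 1"
      using finA by (simp add: card_le_Suc0_iff_eq)
    moreover have "card (A - ?B) = card A - card ?B"
      using finA by (intro card_Diff_subset) auto
    moreover have "A - ?B = {a \<in> A. \<not> overdetermined (A - {a})}"
      by auto
    ultimately show "card A - 1 \<le> card {a \<in> A. \<not> overdetermined (A - {a})}"
      by simp
  qed (use S k in auto)
  moreover have "card ?O + card ?N = n choose k"
  proof -
    have "?O \<union> ?N = {T. T \<subseteq> S \<and> card T = k}" "?O \<inter> ?N = {}"
      by auto
    moreover have "finite ?O" "finite ?N"
      using S by (auto intro: finite_subset[of _ "Pow S"])
    ultimately show ?thesis
      using card_Un_disjoint[of ?O ?N] n_subsets[of S k] S by simp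
  qed
  moreover have "n choose k = ((n - 1) choose (k - 1)) + ((n - 1) choose k)"
    using S(3) k by (intro choose_reduce_nat) auto
  ultimately show ?thesis by simp
qed

text \<open>Used with \<open>m = n - 1\<close>, so that the range is the possible sizes 2 to
  \<open>n\<close>; the top term is zero, and \<open>Suc m\<close> accounts for the missing terms at
  0 and 1.\<close>

lemma sum_binomial_from_2: "(\<Sum>k\<in>{2..Suc m}. m choose k) + Suc m = 2 ^ m"
proof -
  have "(2::nat) ^ m = (\<Sum>k\<le>Suc m. m choose k)"
    using choose_row_sum[of m] by simp
  also have "{..Suc m} = {0, 1} \<union> {2..Suc m}"
    by auto
  also have "(\<Sum>k\<in>{0, 1} \<union> {2..Suc m}. m choose k)
      = (\<Sum>k\<in>{0, 1}. m choose k) + (\<Sum>k\<in>{2..Suc m}. m choose k)"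
    by (rule sum.union_disjoint) auto
  finally show ?thesis by simp
qed

lemma card_overdetermined_subsets_le:
  assumes S: "finite S" "card S = n" "n \<ge> 2" "\<not> overdetermined S"
  shows "card {T. T \<subseteq> S \<and> overdetermined T} + n \<le> 2 ^ (n - 1)"
proof -
  let ?O = "\<lambda>k. {T. T \<subseteq> S \<and> card T = k \<and> overdetermined T}"
  have "{T. T \<subseteq> S \<and> overdetermined T} = (\<Union>k\<in>{2..n}. ?O k)"
    using S card_mono[of S] by (auto simp: overdetermined_def)
  then have "card {T. T \<subseteq> S \<and> overdetermined T} \<le> (\<Sum>k\<in>{2..n}. card (?O k))"
    by (simp add: card_UN_le)
  also have "\<dots> \<le> (\<Sum>k\<in>{2..n}. (n - 1) choose k)"
    by (rule sum_mono) (use S card_overdetermined_subsets_of_size_le in auto)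
  finally show ?thesis
    using sum_binomial_from_2[of "n - 1"] S by simp
qed

lemma card_subsets_card_ge_2:
  assumes "finite L"
  shows "card {T. T \<subseteq> L \<and> card T \<ge> 2} + Suc (card L) = 2 ^ card L"
proof -
  let ?A = "{T. T \<subseteq> L \<and> card T \<ge> 2}" and ?B = "insert {} ((\<lambda>x. {x}) ` L)"
  have un: "Pow L = ?A \<union> ?B"
  proof (intro set_eqI iffI)
    fix T assume T: "T \<in> Pow L"
    then have "finite T" using assms finite_subset by blast
    moreover have "card T \<ge> 2 \<or> card T = 0 \<or> card T = 1" by linarith
    ultimately show "T \<in> ?A \<union> ?B"
      using T by (auto simp: card_1_singleton_iff)
  qed auto
  have "card (Pow L) = card ?A + card ?B"
    unfolding un by (rule card_Un_disjoint) (use assms in auto)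
  moreover have "card ?B = Suc (card L)"
    using assms by (subst card_insert_disjoint) (auto simp: card_image)
  ultimately show ?thesis
    using card_Pow[OF assms] by linarith
qed

lemma admits_overdetermined_count_extremal:
  assumes "n \<ge> 2"
  shows "admits_overdetermined_count n (2 ^ (n - 1) - int n)"
proof -
  \<comment> \<open>Height 1 keeps the constant polynomial through \<open>L\<close> nonzero. The
    point \<open>q\<close> has a new abscissa and lies off the line.\<close>
  define L where "L = (\<lambda>i. (real i, 1 :: real)) ` {..<n - 1}"
  define q where "q = (real n, 2 :: real)"
  have L: "finite L" "card L = n - 1" "\<forall>p\<in>L. snd p = 1"
    unfolding L_def by (auto simp: card_image inj_on_def)
  have q: "q \<notin> L"
    using L(3) by (auto simp: q_def)
  have no: "\<not> overdetermined T" if T: "q \<in> T" "T \<subseteq> insert q L" for T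
  proof
    assume "overdetermined T"
    then obtain P where P: "finite T" "card T \<ge> 2" "degree P \<le> card T - 2"
        "\<forall>(x, y) \<in> T. poly P x = y"
      unfolding overdetermined_def by blast
    \<comment> \<open>The \<open>card T - 1\<close> points of \<open>T\<close> on the line already
      force \<open>P\<close> to be constant, and then \<open>P\<close> misses
      \<open>q\<close>.\<close>
    have "P = 1"
    proof (rule poly_eq_of_common_points[of "T - {q}"])
      show "\<forall>(x, y) \<in> T - {q}. poly P x = y" "\<forall>(x, y) \<in> T - {q}. poly 1 x = y"
        using P(4) T(2) L(3) by fastforce+
    qed (use P T in \<open>auto simp: card_Diff_singleton\<close>)
    then show False
      using P(4) T(1) by (auto simp: q_def)
  qed
  have yes: "overdetermined T" if "T \<subseteq> L" "card T \<ge> 2" for T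
  proof -
    have "\<forall>(x, y) \<in> T. poly 1 x = y"
      using that L(3) by fastforce
    then show ?thesis
      using that L(1) finite_subset unfolding overdetermined_def
      by (intro conjI exI[of _ 1]) auto
  qed
  have "{T. T \<subseteq> insert q L \<and> overdetermined T} = {T. T \<subseteq> L \<and> card T \<ge> 2}"
  proof (intro Collect_cong iffI)
    fix T assume "T \<subseteq> insert q L \<and> overdetermined T"
    then show "T \<subseteq> L \<and> card T \<ge> 2"
      using no[of T] unfolding overdetermined_def by blast
  qed (use yes in auto)
  moreover have "int (card {T. T \<subseteq> L \<and> card T \<ge> 2}) = 2 ^ (n - 1) - int n"
  proof -
    have "card {T. T \<subseteq> L \<and> card T \<ge> 2} + n = 2 ^ (n - 1)"
      using card_subsets_card_ge_2[OF L(1)] L(2) assms by simp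
    then have "int (card {T. T \<subseteq> L \<and> card T \<ge> 2}) + int n = 2 ^ (n - 1)"
      by (metis of_nat_add of_nat_numeral of_nat_power)
    then show ?thesis by simp
  qed
  ultimately show ?thesis
    using L(1,2) q assms no[of "insert q L"] unfolding admits_overdetermined_count_def
    by (intro exI[of _ "insert q L"]) auto
qed

theorem mainTheorem5:
  fixes n :: nat
  assumes "n \<ge> 2"
  shows "admits_overdetermined_count n (2 ^ (n - 1) - int n) \<and>
    (\<forall>k :: int. admits_overdetermined_count n k \<longrightarrow> k \<le> 2 ^ (n - 1) - int n)"
proof (intro conjI allI impI)
  show "admits_overdetermined_count n (2 ^ (n - 1) - int n)"
    using assms by (rule admits_overdetermined_count_extremal)
next
  fix k assume "admits_overdetermined_count n k"
  then obtain S where S: "finite S" "card S = n" "\<not> overdetermined S"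
      "int (card {T. T \<subseteq> S \<and> overdetermined T}) = k"
    unfolding admits_overdetermined_count_def by blast
  have "int (card {T. T \<subseteq> S \<and> overdetermined T} + n) \<le> int (2 ^ (n - 1))"
    using card_overdetermined_subsets_le[OF S(1,2) assms S(3)] by (simp only: of_nat_le_iff)
  then show "k \<le> 2 ^ (n - 1) - int n"
    using S(4) by simp
qed

end
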